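(* For any hypergraph $\mathcal E$ the following conditions are equivalent: (1) each countable subhypergraph of $\mathcal E$ has a minimal cover; (2) each non-empty subhypergraph of $\mathcal E$ has a maximal edge; (3) no subhypergraph of $\mathcal E$ is isomorphic to the hypergraph $\omega$.
   Context: A hypergraph is any family (i.e. set) $\mathcal E$ of sets. Its elements are called edges, and the elements of $\bigcup\mathcal E$ are called its vertices. A hypergraph $\mathcal E$ is countable if both sets $\mathcal E$ and $\bigcup\mathcal E$ are countable. For a hypergraph $\mathcal E$ and a set $A$, put $\mathcal E{\restriction}A:=\{E\cap A:E\in\mathcal E\}$. A hypergraph $\mathcal S$ is a subhypergraph of $\mathcal E$ if $\mathcal S=\mathcal F{\restriction}A$ for some sets $\mathcal F\subseteq\mathcal E$ and $A\subseteq\bigcup\mathcal F$. An edge $E\in\mathcal E$ of a hypergraph $\mathcal E$ is maximal if each edge $E'\in\mathcal E$ with $E\subseteq E'$ is equal to $E$. A subset $\mathcal C\subseteq\mathcal E$ is a cover of the hypergraph $\mathcal E$ if $\bigcup\mathcal C=\bigcup\mathcal E$. A cover $\mathcal C$ of $\mathcal E$ is minimal if each cover $\mathcal D\subseteq\mathcal C$ of $\mathcal E$ coincides with $\mathcal C$. Two hypergraphs $\mathcal E$ and $\mathcal E'$ are isomorphic if there exists a bijective map $f:\bigcup\mathcal E\to\bigcup\mathcal E'$ such that $\mathcal E'=\{f[E]:E\in\mathcal E\}$, where $f[E]=\{f(x):x\in E\}$. The hypergraph $\omega$ is the family of all finite ordinals $n=\{0,\dots,n-1\}$ (including $0=\emptyset$);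 its set of vertices is $\bigcup\omega=\omega=\{0,1,2,\dots\}$. *)

theory Defs
  imports Main "HOL-Library.Countable_Set"
begin

type_synonym 'a hypergraph = "'a set set"

definition countable_hypergraph :: "'a hypergraph \<Rightarrow> bool" where
  "countable_hypergraph \<E> \<longleftrightarrow> countable \<E> \<and> countable (\<Union>\<E>)"

definition trace :: "'a hypergraph \<Rightarrow> 'a set \<Rightarrow> 'a hypergraph" where
  "trace \<E> A = {E \<inter> A |E. E \<in> \<E>}"

definition subhypergraph :: "'a hypergraph \<Rightarrow> 'a hypergraph \<Rightarrow> bool" where
  "subhypergraph \<S> \<E> \<longleftrightarrow> (\<exists>\<F> A. \<F> \<subseteq> \<E> \<and> A \<subseteq> \<Union>\<F> \<and> \<S> = trace \<F> A)"

definition maximal_edge :: "'a hypergraph \<Rightarrow> 'a set \<Rightarrow> bool" where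
  "maximal_edge \<E> E \<longleftrightarrow> E \<in> \<E> \<and> (\<forall>E'\<in>\<E>. E \<subseteq> E' \<longrightarrow> E' = E)"

definition cover :: "'a hypergraph \<Rightarrow> 'a set set \<Rightarrow> bool" where
  "cover \<E> \<C> \<longleftrightarrow> \<C> \<subseteq> \<E> \<and> \<Union>\<C> = \<Union>\<E>"

definition minimal_cover :: "'a hypergraph \<Rightarrow> 'a set set \<Rightarrow> bool" where
  "minimal_cover \<E> \<C> \<longleftrightarrow> cover \<E> \<C> \<and> (\<forall>\<D>. cover \<E> \<D> \<and> \<D> \<subseteq> \<C> \<longrightarrow> \<D> = \<C>)"

definition isomorphic :: "'a hypergraph \<Rightarrow> 'b hypergraph \<Rightarrow> bool" where
  "isomorphic \<E> \<E>' \<longleftrightarrow>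
     (\<exists>f. bij_betw f (\<Union>\<E>) (\<Union>\<E>') \<and> \<E>' = {f ` E |E. E \<in> \<E>})"

(* The finite ordinal n = {0, ..., n - 1} is rendered as {..<n}, so 0 gives the empty edge. *)
definition omega_hypergraph :: "nat hypergraph" where
  "omega_hypergraph = {{..<n} |n. True}"

end

theory Submission
  imports Defs
begin

text \<open>
  Both other conditions are compared with the absence of a copy of \<open>\<omega>\<close>, which is a matter of
  membership alone: a copy of \<open>\<omega>\<close> arises from any vertices \<open>x\<^sub>i\<close> and edges \<open>E\<^sub>n\<close> with
  \<open>x\<^sub>i \<in> E\<^sub>n \<longleftrightarrow> i < n\<close> (a \<^emph>\<open>ladder\<close>), by tracing the edges \<open>E\<^sub>n\<close> on the set of all \<open>x\<^sub>i\<close>.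

  The hypergraph \<open>\<omega>\<close> has no maximal edge, and it has no minimal cover, because a family of initial
  segments covers it iff it is unbounded, and this survives the removal of one member. So maximal
  edges, and likewise minimal covers, exclude copies of \<open>\<omega>\<close>. Conversely, if some subhypergraph has
  edges but no maximal one, then it contains a strictly increasing sequence of edges, and a ladder is
  obtained by picking a new vertex at each step.

  The main point is that a hypergraph without ladders and with countably many vertices has a minimal cover
  (\<open>countable_no_ladder_imp_minimal_cover\<close>). Preorder the vertices by letting \<open>q\<close>
  be above \<open>p\<close> if every edge through \<open>q\<close> passes through \<open>p\<close>. A
  strictly ascending sequence of vertices gives a ladder again (\<open>maximal_vertex_above\<close>), so
  every vertex \<open>x\<close> lies below some maximal vertex \<open>p\<close>. Any edge \<open>E\<close>
  through \<open>p\<close> then covers \<open>x\<close>. Reserve \<open>p\<close> as a private vertex of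
  \<open>E\<close>, that is, never use another edge through \<open>p\<close>. A vertex \<open>q\<close>
  outside \<open>E\<close> is not above \<open>p\<close>, since otherwise maximality would put
  \<open>p\<close> above \<open>q\<close> and hence \<open>q\<close> into \<open>E\<close>; so some edge
  through \<open>q\<close> avoids \<open>p\<close>, and the edges that may still be used cover everything
  outside \<open>E\<close> (\<open>extendable_step\<close>). With countably many vertices this step can be
  repeated until each has had its turn. The chosen edges then form a cover in which every edge has a private
  vertex, which makes the cover minimal.
\<close>

section \<open>Copies of \<open>\<omega>\<close>\<close>

definition ladder :: "'a hypergraph \<Rightarrow> (nat \<Rightarrow> 'a) \<Rightarrow> (nat \<Rightarrow> 'a set) \<Rightarrow> bool" where
  "ladder \<E> x E \<longleftrightarrow> (\<forall>n. E n \<in> \<E> \<and> (\<forall>i. x i \<in> E n \<longleftrightarrow> i < n))"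

lemma ladder_mono: "ladder \<G> x E \<Longrightarrow> \<G> \<subseteq> \<S> \<Longrightarrow> ladder \<S> x E"
  by (auto simp: ladder_def)

lemma isomorphic_omega_iff:
  fixes \<S> :: "'a hypergraph"
  shows "isomorphic \<S> omega_hypergraph \<longleftrightarrow> (\<exists>x :: nat \<Rightarrow> 'a. inj x \<and> \<S> = range (\<lambda>n. x ` {..<n}))"
proof
  assume "isomorphic \<S> omega_hypergraph"
  then obtain f where f: "bij_betw f (\<Union>\<S>) (\<Union>omega_hypergraph)"
    and om: "omega_hypergraph = {f ` E |E. E \<in> \<S>}"
    unfolding isomorphic_def by blast
  have V: "\<Union>omega_hypergraph = UNIV"
    by (auto simp: omega_hypergraph_def)
  define x where "x = inv_into (\<Union>\<S>) f"
  have x: "bij_betw x UNIV (\<Union>\<S>)"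
    using bij_betw_inv_into[OF f] V by (simp add: x_def)
  have xf: "x ` (f ` E) = E" if "E \<in> \<S>" for E
    using f that inv_into_image_cancel[of f "\<Union>\<S>" E]
    unfolding x_def bij_betw_def by blast
  have om_image: "omega_hypergraph = (\<lambda>E. f ` E) ` \<S>"
    unfolding om by (rule Setcompr_eq_image)
  have "(\<lambda>E. x ` E) ` omega_hypergraph = (\<lambda>E. x ` (f ` E)) ` \<S>"
    unfolding om_image by (rule image_image)
  also have "\<dots> = \<S>"
    using xf by (simp cong: image_cong_simp del: image_image)
  finally have "\<S> = (\<lambda>E. x ` E) ` omega_hypergraph" ..
  also have "\<dots> = range (\<lambda>n. x ` {..<n})"
    by (auto simp: omega_hypergraph_def)
  finally show "\<exists>x :: nat \<Rightarrow> 'a. inj x \<and> \<S> = range (\<lambda>n. x ` {..<n})"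
    using x by (auto simp: bij_betw_def)
next
  assume "\<exists>x :: nat \<Rightarrow> 'a. inj x \<and> \<S> = range (\<lambda>n. x ` {..<n})"
  then obtain x :: "nat \<Rightarrow> 'a" where x: "inj x" and S: "\<S> = range (\<lambda>n. x ` {..<n})"
    by blast
  have V: "\<Union>\<S> = range x" "\<Union>omega_hypergraph = UNIV"
    by (auto simp: S omega_hypergraph_def)
  have "bij_betw (inv x) (\<Union>\<S>) (\<Union>omega_hypergraph)"
    unfolding V using x by (simp add: bij_betw_inv_into inj_imp_bij_betw_inv)
  moreover have "{inv x ` E |E. E \<in> \<S>} = range (\<lambda>n. inv x ` (x ` {..<n}))"
    unfolding S by blast
  then have "omega_hypergraph = {inv x ` E |E. E \<in> \<S>}"
    using x by (simp add: omega_hypergraph_def full_SetCompr_eq)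
  ultimately show "isomorphic \<S> omega_hypergraph"
    unfolding isomorphic_def by blast
qed

lemma ladder_imp_omega_subhypergraph:
  assumes "ladder \<E> x E"
  shows "\<exists>\<S>. subhypergraph \<S> \<E> \<and> isomorphic \<S> omega_hypergraph"
proof -
  have E: "E n \<in> \<E>" and x: "x i \<in> E n \<longleftrightarrow> i < n" for n i
    using assms by (auto simp: ladder_def)
  have "inj x"
  proof (rule linorder_injI)
    fix i j :: nat assume "i < j"
    then show "x i \<noteq> x j" using x[of i j] x[of j j] by auto
  qed
  have tr: "E n \<inter> range x = x ` {..<n}" for n
    using x by auto
  have "trace (range E) (range x) = range (\<lambda>n. E n \<inter> range x)"
    by (auto simp: trace_def)
  then have "trace (range E) (range x) = range (\<lambda>n. x ` {..<n})"
    by (simp add: tr)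
  moreover have "range x \<subseteq> \<Union>(range E)"
    using x by blast
  moreover have "range E \<subseteq> \<E>"
    using E by blast
  ultimately have "subhypergraph (range (\<lambda>n. x ` {..<n})) \<E>"
    unfolding subhypergraph_def by metis
  moreover have "isomorphic (range (\<lambda>n. x ` {..<n})) omega_hypergraph"
    using \<open>inj x\<close> isomorphic_omega_iff by blast
  ultimately show ?thesis
    by blast
qed

text \<open>
  Intersecting the edges with \<open>A\<close> does not change which \<open>x\<^sub>i\<close> they contain, because
  \<open>x\<^sub>i \<in> E\<^sub>i\<^sub>+\<^sub>1\<close> forces all \<open>x\<^sub>i\<close> into \<open>A\<close>.
\<close>

lemma ladder_of_subhypergraph:
  assumes "subhypergraph \<S> \<E>" and "ladder \<S> x E"
  shows "\<exists>E'. ladder \<E> x E'"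
proof -
  from assms obtain \<F> A where "\<F> \<subseteq> \<E>" and S: "\<S> = trace \<F> A"
    by (auto simp: subhypergraph_def)
  have "\<forall>n. \<exists>D\<in>\<F>. E n = D \<inter> A"
    using assms(2) unfolding ladder_def S trace_def by blast
  then obtain E' where E': "\<And>n. E' n \<in> \<F>" "\<And>n. E n = E' n \<inter> A"
    by metis
  have x: "x i \<in> E n \<longleftrightarrow> i < n" for i n
    using assms(2) by (simp add: ladder_def)
  then have "x i \<in> A" for i
    using E'(2)[of "Suc i"] by blast
  then have "x i \<in> E' n \<longleftrightarrow> i < n" for i n
    using x[of i n] E'(2)[of n] by blast
  then show ?thesis
    using E'(1) \<open>\<F> \<subseteq> \<E>\<close> unfolding ladder_def by blast
qed

lemma countable_omega_copy:
  fixes \<S> :: "'a hypergraph"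
  assumes "isomorphic \<S> omega_hypergraph"
  shows "countable_hypergraph \<S>"
  using assms by (auto simp: isomorphic_omega_iff countable_hypergraph_def)

lemma omega_copy_no_maximal_edge:
  fixes \<S> :: "'a hypergraph"
  assumes "isomorphic \<S> omega_hypergraph"
  shows "\<not> maximal_edge \<S> E"
proof
  assume max: "maximal_edge \<S> E"
  from assms obtain x :: "nat \<Rightarrow> 'a" where x: "inj x" and S: "\<S> = range (\<lambda>n. x ` {..<n})"
    by (auto simp: isomorphic_omega_iff)
  from max obtain n where n: "E = x ` {..<n}"
    by (auto simp: maximal_edge_def S)
  have "x ` {..<Suc n} \<in> \<S>"
    by (auto simp: S)
  moreover have "E \<subseteq> x ` {..<Suc n}"
    by (auto simp: n)
  ultimately have "x ` {..<Suc n} = x ` {..<n}"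
    using max n by (auto simp: maximal_edge_def)
  then show False
    using x by (simp add: inj_image_eq_iff)
qed

lemma omega_copy_no_minimal_cover:
  fixes \<S> :: "'a hypergraph"
  assumes "isomorphic \<S> omega_hypergraph"
  shows "\<not> minimal_cover \<S> \<C>"
proof
  assume min: "minimal_cover \<S> \<C>"
  from assms obtain x :: "nat \<Rightarrow> 'a" where x: "inj x" and S: "\<S> = range (\<lambda>n. x ` {..<n})"
    by (auto simp: isomorphic_omega_iff)
  have V: "\<Union>\<S> = range x"
    by (auto simp: S)
  have sub: "\<C> \<subseteq> \<S>" and cov: "\<Union>\<C> = range x"
    using min V by (auto simp: minimal_cover_def cover_def)
  have unbounded: "\<exists>m>n. x ` {..<m} \<in> \<C>" for n
  proof -
    have "x n \<in> \<Union>\<C>" using cov by blast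
    then obtain m where "x ` {..<m} \<in> \<C>" "x n \<in> x ` {..<m}"
      using sub S by blast
    then show ?thesis using x by (auto simp: inj_image_mem_iff)
  qed
  then obtain m where m: "x ` {..<m} \<in> \<C>"
    by blast
  have "x i \<in> \<Union>(\<C> - {x ` {..<m}})" for i
  proof -
    obtain k where k: "k > max i m" "x ` {..<k} \<in> \<C>"
      using unbounded by blast
    then have "x ` {..<k} \<noteq> x ` {..<m}"
      using x by (simp add: inj_image_eq_iff)
    moreover have "x i \<in> x ` {..<k}"
      using k by auto
    ultimately show ?thesis using k by blast
  qed
  then have "cover \<S> (\<C> - {x ` {..<m}})"
    using sub cov V by (auto simp: cover_def)
  then have "\<C> - {x ` {..<m}} = \<C>"
    using min by (auto simp: minimal_cover_def)
  then show False
    using m by blast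
qed

section \<open>Maximal edges\<close>

lemma no_maximal_edge_imp_ladder:
  assumes "\<S> \<noteq> {}" and "\<nexists>E. maximal_edge \<S> E"
  shows "\<exists>x E. ladder \<S> x E"
proof -
  have "\<exists>E. \<forall>n. E n \<in> \<S> \<and> E n \<subset> E (Suc n)"
  proof (rule dependent_nat_choice)
    show "\<exists>E. E \<in> \<S>" using assms(1) by blast
    show "\<exists>E'. E' \<in> \<S> \<and> E \<subset> E'" if "E \<in> \<S>" for E and n :: nat
      using assms(2) that by (auto simp: maximal_edge_def)
  qed
  then obtain E where E: "\<And>n. E n \<in> \<S>" "\<And>n. E n \<subset> E (Suc n)"
    by blast
  have mono: "E m \<subseteq> E n" if "m \<le> n" for m n
    using lift_Suc_mono_le[of E, OF psubset_imp_subset[OF E(2)] that] .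
  have "\<forall>n. \<exists>v. v \<in> E (Suc n) - E n"
    using E(2) by blast
  then obtain x where x: "\<And>n. x n \<in> E (Suc n) - E n"
    by metis
  have "x i \<in> E n \<longleftrightarrow> i < n" for i n
    using x[of i] mono[of "Suc i" n] mono[of n i] by (cases "i < n") auto
  then show ?thesis
    using E(1) unfolding ladder_def by blast
qed

section \<open>Minimal covers\<close>

text \<open>
  In the preorder of the vertices in which \<open>q\<close> is above \<open>p\<close> if the edges through \<open>q\<close> all pass
  through \<open>p\<close>, an infinite strictly ascending sequence \<open>p\<^sub>n\<close> yields a ladder: some edge contains
  \<open>p\<^sub>n\<close> but not \<open>p\<^sub>n\<^sub>+\<^sub>1\<close>, hence contains the vertices up to \<open>p\<^sub>n\<close> and no later ones.
\<close>

lemma maximal_vertex_above: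
  assumes noladder: "\<nexists>x E. ladder \<G> x E" and "v \<in> U"
  shows "\<exists>p\<in>U. (\<forall>E\<in>\<G>. p \<in> E \<longrightarrow> v \<in> E) \<and>
           (\<forall>q\<in>U. (\<forall>E\<in>\<G>. q \<in> E \<longrightarrow> p \<in> E) \<longrightarrow> (\<forall>E\<in>\<G>. p \<in> E \<longrightarrow> q \<in> E))"
proof (rule ccontr)
  assume no_max: "\<not> ?thesis"
  define le where "le p q \<longleftrightarrow> (\<forall>E\<in>\<G>. q \<in> E \<longrightarrow> p \<in> E)" for p q
  have "\<not> (\<exists>p\<in>U. le v p \<and> (\<forall>q\<in>U. le p q \<longrightarrow> le q p))"
    using no_max unfolding le_def .
  then have step: "\<exists>q\<in>U. le p q \<and> \<not> le q p" if "p \<in> U" "le v p" for p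
    using that by blast
  have "\<exists>p. \<forall>n. (p n \<in> U \<and> le v (p n)) \<and> (le (p n) (p (Suc n)) \<and> \<not> le (p (Suc n)) (p n))"
  proof (rule dependent_nat_choice)
    show "\<exists>p. p \<in> U \<and> le v p"
      using assms(2) by (auto simp: le_def)
    show "\<exists>q. (q \<in> U \<and> le v q) \<and> (le p q \<and> \<not> le q p)" if "p \<in> U \<and> le v p" for p and n :: nat
      using step[of p] that by (auto simp: le_def)
  qed
  then obtain p where p: "\<And>n. le (p n) (p (Suc n))" "\<And>n. \<not> le (p (Suc n)) (p n)"
    by blast
  have mono: "le (p m) (p n)" if "m \<le> n" for m n
    using that
  proof (induction rule: dec_induct)
    case base
    show ?case by (simp add: le_def)
  next
    case (step n)
    then show ?case using p(1)[of n] by (simp add: le_def)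
  qed
  have "\<forall>n. \<exists>E\<in>\<G>. p n \<in> E \<and> p (Suc n) \<notin> E"
    using p(2) by (auto simp: le_def)
  then obtain E where E: "\<And>n. E n \<in> \<G>" "\<And>n. p n \<in> E n" "\<And>n. p (Suc n) \<notin> E n"
    by metis
  \<comment> \<open>The edge \<open>E 0\<close> contains \<open>p 0\<close>, so the ladder has to start with the vertex \<open>p 1\<close>.\<close>
  have "p (Suc i) \<in> E n \<longleftrightarrow> i < n" for i n
    using mono[of "Suc i" n] mono[of "Suc n" "Suc i"] E[of n]
    by (cases "i < n") (auto simp: le_def)
  then have "ladder \<G> (\<lambda>i. p (Suc i)) E"
    using E(1) by (simp add: ladder_def)
  with noladder show False
    by blast
qed

text \<open>
  A partial cover is recorded together with the private vertices of its edges, because both the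
  edges already used and the vertices already reserved constrain later choices. The direction from
  right to left of the equivalence puts each private vertex into its own edge, and the other
  direction keeps it out of all other edges and makes both components injective.
\<close>

definition private_system :: "'a hypergraph \<Rightarrow> ('a \<times> 'a set) set \<Rightarrow> bool" where
  "private_system \<S> R \<longleftrightarrow> snd ` R \<subseteq> \<S> \<and> (\<forall>r\<in>R. \<forall>s\<in>R. fst r \<in> snd s \<longleftrightarrow> r = s)"

definition available :: "'a hypergraph \<Rightarrow> ('a \<times> 'a set) set \<Rightarrow> 'a hypergraph" where
  "available \<S> R = {E \<in> \<S>. E \<inter> fst ` R = {}}"

lemma available_subset: "available \<S> R \<subseteq> \<S>"
  by (auto simp: available_def)

text \<open>
  The second condition keeps the construction alive: no uncovered vertex has been locked out by the
  reservations.
\<close>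

definition extendable :: "'a hypergraph \<Rightarrow> ('a \<times> 'a set) set \<Rightarrow> bool" where
  "extendable \<S> R \<longleftrightarrow> private_system \<S> R \<and> \<Union>\<S> \<subseteq> \<Union>(snd ` R) \<union> \<Union>(available \<S> R)"

lemma private_system_cover_minimal:
  assumes R: "private_system \<S> R" and cov: "\<Union>(snd ` R) = \<Union>\<S>"
  shows "minimal_cover \<S> (snd ` R)"
  unfolding minimal_cover_def
proof (intro conjI allI impI)
  show "cover \<S> (snd ` R)"
    using assms by (auto simp: cover_def private_system_def)
next
  fix \<D> assume D: "cover \<S> \<D> \<and> \<D> \<subseteq> snd ` R"
  have "snd r \<in> \<D>" if "r \<in> R" for r
  proof -
    have "fst r \<in> snd r"
      using R that by (auto simp: private_system_def)
    then have "fst r \<in> \<Union>\<D>"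
      using D cov that by (auto simp: cover_def)
    then obtain s where "s \<in> R" "snd s \<in> \<D>" "fst r \<in> snd s"
      using D by blast
    then show ?thesis
      using R that by (auto simp: private_system_def)
  qed
  then show "\<D> = snd ` R"
    using D by blast
qed

text \<open>
  The new edge goes through a maximal vertex above \<open>v\<close>, where the preorder refers to uncovered
  vertices and available edges. Being above \<open>v\<close> is what makes this edge cover \<open>v\<close>, and
  maximality is what allows the vertex to be reserved.
\<close>

lemma extendable_step:
  assumes noladder: "\<nexists>x E. ladder \<S> x E" and R: "extendable \<S> R" and v: "v \<in> \<Union>\<S>"
  shows "\<exists>R'. extendable \<S> R' \<and> R \<subseteq> R' \<and> v \<in> \<Union>(snd ` R')"
proof (cases "v \<in> \<Union>(snd ` R)")
  case True
  then show ?thesis using R by blast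
next
  case False
  let ?U = "\<Union>\<S> - \<Union>(snd ` R)" and ?G = "available \<S> R"
  have "\<nexists>x E. ladder ?G x E"
    using noladder ladder_mono[of ?G _ _ \<S>] by (metis available_subset)
  moreover have "v \<in> ?U"
    using v False by blast
  ultimately have "\<exists>p\<in>?U. (\<forall>E\<in>?G. p \<in> E \<longrightarrow> v \<in> E) \<and>
      (\<forall>q\<in>?U. (\<forall>E\<in>?G. q \<in> E \<longrightarrow> p \<in> E) \<longrightarrow> (\<forall>E\<in>?G. p \<in> E \<longrightarrow> q \<in> E))"
    by (rule maximal_vertex_above)
  then obtain p where p: "p \<in> ?U" and pv: "\<forall>E\<in>?G. p \<in> E \<longrightarrow> v \<in> E"
    and pmax: "\<forall>q\<in>?U. (\<forall>E\<in>?G. q \<in> E \<longrightarrow> p \<in> E) \<longrightarrow> (\<forall>E\<in>?G. p \<in> E \<longrightarrow> q \<in> E)"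
    by (elim bexE conjE)
  have "p \<in> \<Union>?G"
    using p R by (auto simp: extendable_def)
  then obtain E where E: "E \<in> ?G" "p \<in> E"
    by blast
  let ?R = "insert (p, E) R"
  have "private_system \<S> ?R"
    unfolding private_system_def
  proof (intro conjI ballI)
    show "snd ` ?R \<subseteq> \<S>"
      using R E by (auto simp: extendable_def private_system_def available_def)
  next
    fix r s assume rs: "r \<in> ?R" "s \<in> ?R"
    have old: "fst r \<in> snd s \<longleftrightarrow> r = s" if "r \<in> R" "s \<in> R" for r s
      using R that by (auto simp: extendable_def private_system_def)
    have "p \<notin> snd s" if "s \<in> R" for s
      using p that by blast
    moreover have "fst r \<notin> E" if "r \<in> R" for r
      using E that by (auto simp: available_def)
    ultimately show "fst r \<in> snd s \<longleftrightarrow> r = s"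
      using rs E(2) old by (metis fst_conv snd_conv insert_iff)
  qed
  moreover have "q \<in> \<Union>(snd ` ?R) \<union> \<Union>(available \<S> ?R)" if "q \<in> \<Union>\<S>" for q
  proof (cases "q \<in> \<Union>(snd ` ?R)")
    case False
    then have q: "q \<in> ?U" "q \<notin> E"
      using that by auto
    have "\<not> (\<forall>D\<in>?G. q \<in> D \<longrightarrow> p \<in> D)"
      using pmax[rule_format, OF q(1) _ E] q(2) by metis
    then obtain D where "D \<in> ?G" "q \<in> D" "p \<notin> D"
      by blast
    then have "D \<in> available \<S> ?R"
      by (auto simp: available_def)
    then show ?thesis using \<open>q \<in> D\<close> by blast
  qed blast
  ultimately have "extendable \<S> ?R"
    by (auto simp: extendable_def)
  moreover have "v \<in> \<Union>(snd ` ?R)"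
    using pv E by simp
  ultimately show ?thesis
    by blast
qed

text \<open>
  Countability matters because only finite stages are guaranteed to be extendable: at a limit, a
  vertex may lose all its available edges one by one. After \<open>\<omega>\<close> steps this does no harm, because
  every vertex has been covered.
\<close>

lemma countable_no_ladder_imp_minimal_cover:
  assumes noladder: "\<nexists>x E. ladder \<S> x E" and "countable (\<Union>\<S>)"
  shows "\<exists>\<C>. minimal_cover \<S> \<C>"
proof -
  define v where "v = from_nat_into (\<Union>\<S>)"
  have v: "\<Union>\<S> \<subseteq> range v"
    using assms(2) by (simp add: v_def subset_range_from_nat_into)
  have "\<exists>R. \<forall>n. extendable \<S> (R n) \<and>
          (R n \<subseteq> R (Suc n) \<and> (v n \<in> \<Union>\<S> \<longrightarrow> v n \<in> \<Union>(snd ` R (Suc n))))"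
  proof (rule dependent_nat_choice)
    have "extendable \<S> {}"
      by (auto simp: extendable_def private_system_def available_def)
    then show "\<exists>R. extendable \<S> R" ..
    show "\<exists>R'. extendable \<S> R' \<and> (R \<subseteq> R' \<and> (v n \<in> \<Union>\<S> \<longrightarrow> v n \<in> \<Union>(snd ` R')))"
      if "extendable \<S> R" for R n
      using extendable_step[OF noladder that, of "v n"] that by blast
  qed
  then obtain R where R: "\<And>n. extendable \<S> (R n)" "\<And>n. R n \<subseteq> R (Suc n)"
    and cov: "\<And>n. v n \<in> \<Union>\<S> \<Longrightarrow> v n \<in> \<Union>(snd ` R (Suc n))"
    by blast
  have ps: "private_system \<S> (R n)" for n
    using R(1) by (simp add: extendable_def)
  have mono: "R m \<subseteq> R n" if "m \<le> n" for m n
    using lift_Suc_mono_le[of R, OF R(2) that] .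
  let ?R = "\<Union>n. R n"
  have "private_system \<S> ?R"
    unfolding private_system_def
  proof (intro conjI ballI)
    show "snd ` ?R \<subseteq> \<S>"
      using ps by (auto simp: private_system_def)
  next
    fix r s assume "r \<in> ?R" "s \<in> ?R"
    then obtain m n where "r \<in> R m" "s \<in> R n"
      by blast
    then have "r \<in> R (max m n)" "s \<in> R (max m n)"
      using mono[of m "max m n"] mono[of n "max m n"] by auto
    then show "fst r \<in> snd s \<longleftrightarrow> r = s"
      using ps[of "max m n"] by (auto simp: private_system_def)
  qed
  moreover have "\<Union>(snd ` ?R) = \<Union>\<S>"
  proof
    show "\<Union>(snd ` ?R) \<subseteq> \<Union>\<S>"
      using ps by (auto simp: private_system_def)
    show "\<Union>\<S> \<subseteq> \<Union>(snd ` ?R)"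
    proof
      fix y assume y: "y \<in> \<Union>\<S>"
      then obtain n where "y = v n"
        using v by blast
      then have "y \<in> \<Union>(snd ` R (Suc n))"
        using cov y by blast
      then show "y \<in> \<Union>(snd ` ?R)"
        by blast
    qed
  qed
  ultimately show ?thesis
    using private_system_cover_minimal by blast
qed

section \<open>The characterization\<close>

theorem theorem1p1:
  fixes \<E> :: "'a hypergraph"
  shows "((\<forall>\<S>. subhypergraph \<S> \<E> \<and> countable_hypergraph \<S> \<longrightarrow> (\<exists>\<C>. minimal_cover \<S> \<C>))
            \<longleftrightarrow> (\<forall>\<S>. subhypergraph \<S> \<E> \<and> \<S> \<noteq> {} \<longrightarrow> (\<exists>E. maximal_edge \<S> E)))
       \<and> ((\<forall>\<S>. subhypergraph \<S> \<E> \<and> \<S> \<noteq> {} \<longrightarrow> (\<exists>E. maximal_edge \<S> E))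
            \<longleftrightarrow> \<not> (\<exists>\<S>. subhypergraph \<S> \<E> \<and> isomorphic \<S> omega_hypergraph))"
  (is "(?covers \<longleftrightarrow> ?edges) \<and> (?edges \<longleftrightarrow> ?no_omega)")
proof -
  have noladder: "\<nexists>x E. ladder \<S> x E" if ?no_omega "subhypergraph \<S> \<E>" for \<S>
    using that ladder_of_subhypergraph ladder_imp_omega_subhypergraph by metis
  have "?no_omega" if ?covers
    using that countable_omega_copy omega_copy_no_minimal_cover by blast
  moreover have "?covers" if ?no_omega
    using noladder[OF that] countable_no_ladder_imp_minimal_cover
    unfolding countable_hypergraph_def by metis
  moreover have "?no_omega" if ?edges
  proof
    assume "\<exists>\<S>. subhypergraph \<S> \<E> \<and> isomorphic \<S> omega_hypergraph"
    then obtain \<S> where S: "subhypergraph \<S> \<E>" "isomorphic \<S> omega_hypergraph"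
      by blast
    then have "\<S> \<noteq> {}"
      by (auto simp: isomorphic_omega_iff)
    then show False
      using that S omega_copy_no_maximal_edge by blast
  qed
  moreover have "?edges" if ?no_omega
    using noladder[OF that] no_maximal_edge_imp_ladder by metis
  ultimately show ?thesis
    by blast
qed

end
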